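(* Fix $\sigma>0$ and $t_1,t_2>0$ with $t_1\neq t_2$. For $x_0,\mu\in\mathbb{R}$ and $i\in\{1,2\}$ let $\gamma_{(x_0,\mu,t_i)}$ denote the Gaussian probability measure on $\mathbb{R}$ with mean $x_0+\mu t_i$ and variance $\sigma^2 t_i$, and put $\gamma_{(x_0,\mu)}=\gamma_{(x_0,\mu,t_1)}\times\gamma_{(x_0,\mu,t_2)}$, a probability measure on $\mathbb{R}^2$. For $n\ge1$ define $\mathbf{T}_n:(\mathbb{R}^2)^n\to\mathbb{R}^2$ by $$\mathbf{T}_n\big((z^{(1)}_k,z^{(2)}_k)_{1\le k\le n}\big)=\left(\frac{\sum_{k=1}^n\big(t_2z^{(1)}_k-t_1z^{(2)}_k\big)}{n(t_2-t_1)},\ \frac{\sum_{k=1}^n\big(z^{(2)}_k-z^{(1)}_k\big)}{n(t_2-t_1)}\right).$$ Then for every $(x_0,\mu)\in\mathbb{R}^2$, $$\gamma_{(x_0,\mu)}^{\infty}\Big(\Big\{(z^{(1)}_k,z^{(2)}_k)_{k\in\mathbb{N}}\in(\mathbb{R}^2)^\infty:\ \lim_{n\to\infty}\mathbf{T}_n\big((z^{(1)}_k,z^{(2)}_k)_{1\le k\le n}\big)=(x_0,\mu)\Big\}\Big)=1,$$ that is, $(\mathbf{T}_n)_{n\ge1}$ is a consistent estimator (in the sense of everywhere convergence) of the parameter $(x_0,\mu)$ for the family $(\gamma_{(x_0,\mu)}^\infty)_{(x_0,\mu)\in\mathbb{R}^2}$.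
   Context: $\mathbb{N}=\{1,2,\dots\}$, and $(\mathbb{R}^2)^{\infty}=(\mathbb{R}^2)^{\mathbb{N}}$ is the space of sequences in $\mathbb{R}^2$ with its Borel (product) $\sigma$-algebra. For a Borel probability measure $\gamma$ on $\mathbb{R}^2$, $\gamma^{\infty}$ is the infinite product measure on $(\mathbb{R}^2)^{\infty}$. The measure $\gamma_{(x_0,\mu,t_i)}$ is the law at time $t_i$ of the Wiener process with drift $X_t=x_0+\mu t+\sigma W_t$; the two coordinates $z^{(1)}_k,z^{(2)}_k$ correspond to observations on different (independent) trajectories at times $t_1$ and $t_2$. A sequence of Borel measurable functions $\mathbf{T}_n:(\mathbb{R}^2)^n\to\mathbb{R}^2$ is called a consistent estimator of $\theta$ (in the sense of everywhere convergence) for a family $(\gamma_\theta^\infty)_{\theta\in\mathbb{R}^2}$ of infinite powers of Borel probability measures on $\mathbb{R}^2$ if $\gamma_\theta^\infty(\{(x_k)_{k\in\mathbb{N}}:\lim_{n\to\infty}\mathbf{T}_n(x_1,\dots,x_n)=\theta\})=1$ for each $\theta\in\mathbb{R}^2$. *)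

theory Defs
  imports "HOL-Probability.Probability"
begin

text \<open>
  The plane is \<^typ>\<open>real \<times> real\<close>. Since the natural numbers of the source start at 1, sequences
  are indexed by \<^term>\<open>{1..} :: nat set\<close>, and n-tuples by \<^term>\<open>{1..n}\<close>; as usual for
  \<^const>\<open>PiM\<close>, they are functions that are \<^const>\<open>undefined\<close> outside the index set.
\<close>

text \<open>\<^const>\<open>normal_density\<close> takes the standard deviation, so variance \<open>\<sigma>\<^sup>2 t\<close> becomes a square root.\<close>

definition drift_gauss :: "real \<Rightarrow> real \<Rightarrow> real \<Rightarrow> real \<Rightarrow> real measure" where
  "drift_gauss \<sigma> x0 \<mu> t = density lborel (normal_density (x0 + \<mu> * t) (sqrt (\<sigma>\<^sup>2 * t)))"

definition drift_gauss2 ::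
    "real \<Rightarrow> real \<Rightarrow> real \<Rightarrow> real \<Rightarrow> real \<Rightarrow> (real \<times> real) measure" where
  "drift_gauss2 \<sigma> t1 t2 x0 \<mu> = drift_gauss \<sigma> x0 \<mu> t1 \<Otimes>\<^sub>M drift_gauss \<sigma> x0 \<mu> t2"

definition infinite_power :: "'a measure \<Rightarrow> (nat \<Rightarrow> 'a) measure" where
  "infinite_power M = PiM {1..} (\<lambda>_. M)"

text \<open>
  The family must consist of Borel probability measures. The \<open>n\<close>-th statistic is a function of
  \<open>n\<close>-tuples only: it is applied to the restriction of the sequence to the first \<open>n\<close> indices.
  Its value at \<open>n = 0\<close> is irrelevant.
\<close>

definition consistent_estimator ::
    "(nat \<Rightarrow> (nat \<Rightarrow> real \<times> real) \<Rightarrow> real \<times> real) \<Rightarrow>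
     (real \<times> real \<Rightarrow> (real \<times> real) measure) \<Rightarrow> bool" where
  "consistent_estimator T \<gamma> \<longleftrightarrow>
     (\<forall>\<theta>. prob_space (\<gamma> \<theta>) \<and> sets (\<gamma> \<theta>) = sets borel) \<and>
     (\<forall>n\<ge>1. T n \<in> measurable (PiM {1..n} (\<lambda>_. borel)) borel) \<and>
     (\<forall>\<theta>. measure (infinite_power (\<gamma> \<theta>))
            {x \<in> space (infinite_power (\<gamma> \<theta>)).
               (\<lambda>n. T n (restrict x {1..n})) \<longlonglongrightarrow> \<theta>} = 1)"

definition drift_estimator ::
    "real \<Rightarrow> real \<Rightarrow> nat \<Rightarrow> (nat \<Rightarrow> real \<times> real) \<Rightarrow> real \<times> real" where
  "drift_estimator t1 t2 n z =
     ((\<Sum>k=1..n. t2 * fst (z k) - t1 * snd (z k)) / (real n * (t2 - t1)),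
      (\<Sum>k=1..n. snd (z k) - fst (z k)) / (real n * (t2 - t1)))"

end

theory Submission
  imports Defs
begin

text \<open>
  Averages of i.i.d. Gaussian variables are Gaussian with variance \<open>s\<^sup>2 / n\<close>, so their fourth central
  moments \<open>3 s\<^sup>4 / n\<^sup>2\<close> are summable. Hence the series of fourth powers of the deviations converges
  almost surely and the averages converge to the mean. Both components of the estimator are linear
  combinations of the averages of the two coordinate sequences, and the same combinations of the
  means \<open>x0 + \<mu> t1\<close> and \<open>x0 + \<mu> t2\<close> are \<open>x0\<close> and \<open>\<mu>\<close>.
\<close>

text \<open>Exchanging sum and integral shows that the series has a finite integral. It is therefore
  finite almost everywhere, and the terms of a convergent series tend to 0.\<close>

lemma AE_tendsto_0_if_summable_integral:
  fixes f :: "nat \<Rightarrow> 'a \<Rightarrow> real"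
  assumes int: "\<And>n. integrable M (f n)"
    and nonneg: "\<And>n x. 0 \<le> f n x"
    and summable: "summable (\<lambda>n. integral\<^sup>L M (f n))"
  shows "AE x in M. (\<lambda>n. f n x) \<longlonglongrightarrow> 0"
proof -
  have [measurable]: "f n \<in> borel_measurable M" for n
    using int by auto
  have "(\<integral>\<^sup>+x. (\<Sum>n. ennreal (f n x)) \<partial>M) = (\<Sum>n. \<integral>\<^sup>+x. ennreal (f n x) \<partial>M)"
    by (rule nn_integral_suminf) measurable
  also have "\<dots> = (\<Sum>n. ennreal (integral\<^sup>L M (f n)))"
    using int nonneg by (simp add: nn_integral_eq_integral)
  also have "\<dots> = ennreal (\<Sum>n. integral\<^sup>L M (f n))"
    using nonneg summable by (intro suminf_ennreal2) auto
  finally have "(\<integral>\<^sup>+x. (\<Sum>n. ennreal (f n x)) \<partial>M) \<noteq> \<infinity>"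
    by simp
  then have "AE x in M. (\<Sum>n. ennreal (f n x)) \<noteq> \<infinity>"
    by (intro nn_integral_PInf_AE) measurable
  then show ?thesis
    by eventually_elim (use nonneg in \<open>auto intro!: summable_LIMSEQ_zero summable_suminf_not_top\<close>)
qed

text \<open>Second moments would not do: the variances s^2 / n of the averages are not summable. The
  fourth is the first even moment whose decay, of order 1 / n^2, is fast enough.\<close>

lemma (in prob_space) AE_gaussian_average_tendsto:
  fixes X :: "nat \<Rightarrow> 'a \<Rightarrow> real"
  assumes indep: "indep_vars (\<lambda>_. borel) X {1..}"
    and distr: "\<And>k. k \<ge> 1 \<Longrightarrow> distributed M lborel (X k) (normal_density m s)"
    and s: "s > 0"
  shows "AE x in M. (\<lambda>n. (\<Sum>k=1..n. X k x) / real n) \<longlonglongrightarrow> m"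
proof -
  \<comment> \<open>The shift to \<open>Suc n\<close> excludes the empty average, which has no
    normal density; \<open>LIMSEQ_imp_Suc\<close> undoes it at the end.\<close>
  define A where "A n x = (\<Sum>k=1..Suc n. X k x) / real (Suc n)" for n x
  define \<tau> where "\<tau> n = s / sqrt (real (Suc n))" for n
  have \<tau>: "\<tau> n > 0" for n
    using s by (simp add: \<tau>_def)
  have A: "distributed M lborel (A n) (normal_density m (\<tau> n))" for n
  proof -
    have "distributed M lborel (\<lambda>x. \<Sum>k=1..Suc n. X k x)
        (normal_density (\<Sum>k=1..Suc n. m) (sqrt (\<Sum>k=1..Suc n. s\<^sup>2)))"
      using s distr
      by (intro sum_indep_normal indep_vars_subset[OF indep]) auto
    moreover have "sqrt (real (Suc n) * s\<^sup>2) = sqrt (real (Suc n)) * s"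
      using s by (simp add: real_sqrt_mult)
    ultimately have "distributed M lborel (\<lambda>x. \<Sum>k=1..Suc n. X k x)
        (normal_density (real (Suc n) * m) (sqrt (real (Suc n)) * s))"
      by simp
    \<comment> \<open>The average is written as an affine image with offset 0, the shape that
      \<open>normal_density_affine\<close> expects.\<close>
    then have "distributed M lborel (\<lambda>x. 0 + 1 / real (Suc n) * (\<Sum>k=1..Suc n. X k x))
        (normal_density (0 + 1 / real (Suc n) * (real (Suc n) * m))
          (\<bar>1 / real (Suc n)\<bar> * (sqrt (real (Suc n)) * s)))"
      using s by (intro normal_density_affine) auto
    moreover have "\<bar>1 / real (Suc n)\<bar> * (sqrt (real (Suc n)) * s) = \<tau> n"
      using real_div_sqrt[of "real (Suc n)"] by (simp add: \<tau>_def field_simps)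
    moreover have "(\<lambda>x. 0 + 1 / real (Suc n) * (\<Sum>k=1..Suc n. X k x)) = A n"
      by (simp add: A_def fun_eq_iff)
    ultimately show ?thesis
      by simp
  qed
  have moment: "has_bochner_integral lborel (\<lambda>x. normal_density m (\<tau> n) x * (x - m) ^ 4)
      (3 * s ^ 4 * inverse (real (Suc n) ^ 2))" for n
  proof -
    have sqrt4: "sqrt (real (Suc n)) ^ 4 = real (Suc n) ^ 2"
      using power_mult[of "sqrt (real (Suc n))" 2 2] by simp
    \<comment> \<open>The left-hand side is the formula of \<open>normal_moment_even\<close> for the
      central moment of order 2 * 2.\<close>
    have "fact (2 * 2) / ((2 / (\<tau> n)\<^sup>2)\<^sup>2 * fact 2) = 3 * (\<tau> n) ^ 4"
      by (simp add: fact_numeral power_divide flip: power_mult)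
    also have "(\<tau> n) ^ 4 = s ^ 4 * inverse (real (Suc n) ^ 2)"
      unfolding \<tau>_def power_divide sqrt4 by (simp add: divide_inverse)
    finally show ?thesis
      using normal_moment_even[OF \<tau>, of m n 2] by (simp add: mult.assoc)
  qed
  have "AE x in M. (\<lambda>n. (A n x - m) ^ 4) \<longlonglongrightarrow> 0"
  proof (rule AE_tendsto_0_if_summable_integral)
    show "integrable M (\<lambda>x. (A n x - m) ^ 4)" for n
      using moment[THEN integrable.intros, of n]
      by (subst distributed_integrable[OF A, symmetric]) auto
    have "(\<integral>x. (A n x - m) ^ 4 \<partial>M) = 3 * s ^ 4 * inverse (real (Suc n) ^ 2)" for n
      using moment[THEN has_bochner_integral_integral_eq, of n]
      by (subst distributed_integral[OF A, symmetric]) auto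
    moreover have "summable (\<lambda>n. inverse (real (Suc n) ^ 2))"
      using inverse_power_summable[of 2, where 'a = real]
      by (subst summable_Suc_iff) auto
    ultimately show "summable (\<lambda>n. \<integral>x. (A n x - m) ^ 4 \<partial>M)"
      by (simp add: summable_mult)
  qed simp
  then show ?thesis
  proof eventually_elim
    case (elim x)
    \<comment> \<open>Continuity of the fourth root turns convergence of the powers into convergence
      of the absolute deviations.\<close>
    have "(\<lambda>n. root 4 ((A n x - m) ^ 4)) \<longlonglongrightarrow> root 4 0"
      by (intro tendsto_intros elim)
    moreover have "root 4 (y ^ 4) = \<bar>y\<bar>" for y :: real
      using real_root_power_cancel[of 4 "\<bar>y\<bar>"] by simp
    ultimately have "(\<lambda>n. A n x - m) \<longlonglongrightarrow> 0"
      by (simp add: tendsto_rabs_zero_iff)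
    then have "(\<lambda>n. A n x) \<longlonglongrightarrow> m"
      by (simp add: LIM_zero_iff)
    then show ?case
      unfolding A_def by (rule LIMSEQ_imp_Suc)
  qed
qed

text \<open>Under the product measure the coordinates are independent with law \<open>M\<close>, so
  the variables \<open>g (z k)\<close> are independent and normal. A general \<open>g\<close> lets
  both projections of the plane be treated at once.\<close>

lemma AE_PiM_gaussian_average_tendsto:
  fixes g :: "'a \<Rightarrow> real"
  assumes M: "prob_space M"
    and g: "distributed M lborel g (normal_density m s)"
    and s: "s > 0"
  shows "AE z in PiM {1..} (\<lambda>_. M). (\<lambda>n. (\<Sum>k=1..n. g (z k)) / real n) \<longlonglongrightarrow> m"
proof -
  let ?P = "PiM {1::nat..} (\<lambda>_. M)"
  interpret P: prob_space ?P
    using M by (intro prob_space_PiM)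
  have [measurable]: "g \<in> borel_measurable M"
    using g by (simp add: distributed_def)
  have component: "distr ?P M (\<lambda>z. z k) = M" if "k \<ge> 1" for k
    using M that by (intro distr_PiM_component) auto
  have "P.indep_vars (\<lambda>_. M) (\<lambda>k z. z k) {1..}"
  proof (subst P.indep_vars_iff_distr_eq_PiM')
    \<comment> \<open>Independence means that the joint law is the product of the marginals. The
      joint map is a restriction to \<open>{1..}\<close>, which is the identity on the space because
      its elements are extensional.\<close>
    have "distr ?P ?P (\<lambda>z. restrict z {1..}) = distr ?P ?P (\<lambda>z. z)"
      by (intro distr_cong) (auto simp: space_PiM)
    also have "\<dots> = ?P"
      by simp
    also have "\<dots> = PiM {1..} (\<lambda>k. distr ?P M (\<lambda>z. z k))"
      using component by (intro PiM_cong) auto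
    finally show "distr ?P ?P (\<lambda>z. \<lambda>k\<in>{1..}. z k) = PiM {1..} (\<lambda>k. distr ?P M (\<lambda>z. z k))" .
  qed auto
  then have "P.indep_vars (\<lambda>_. borel) (\<lambda>k z. g (z k)) {1..}"
    by (rule P.indep_vars_compose2) measurable
  moreover have "distributed ?P lborel (\<lambda>z. g (z k)) (normal_density m s)" if "k \<ge> 1" for k
  proof -
    have "distr ?P lborel (\<lambda>z. g (z k)) = distr (distr ?P M (\<lambda>z. z k)) lborel g"
      using that by (subst distr_distr) (auto simp: comp_def)
    then show ?thesis
      using g that component by (auto simp: distributed_def)
  qed
  ultimately show ?thesis
    using s by (rule P.AE_gaussian_average_tendsto)
qed

text \<open>The preimage of \<open>A\<close> under \<open>snd\<close> is the rectangle
  \<open>space M \<times> A\<close>, and its first side has mass 1.\<close>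

lemma (in prob_space) distr_pair_snd:
  assumes "prob_space N"
  shows "distr (M \<Otimes>\<^sub>M N) N snd = N"
proof (intro measure_eqI)
  interpret N: prob_space N by fact
  fix A assume "A \<in> sets (distr (M \<Otimes>\<^sub>M N) N snd)"
  then have A: "A \<in> sets N" by simp
  then have "snd -` A \<inter> space (M \<Otimes>\<^sub>M N) = space M \<times> A"
    by (auto simp: space_pair_measure dest: sets.sets_into_space)
  with A show "emeasure (distr (M \<Otimes>\<^sub>M N) N snd) A = emeasure N A"
    by (simp add: emeasure_distr N.emeasure_pair_measure_Times emeasure_space_1)
qed simp

lemma sets_drift_gauss [measurable_cong]: "sets (drift_gauss \<sigma> x0 \<mu> t) = sets borel"
  by (simp add: drift_gauss_def)

lemma prob_space_drift_gauss:
  assumes "\<sigma> > 0" "t > 0"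
  shows "prob_space (drift_gauss \<sigma> x0 \<mu> t)"
  unfolding drift_gauss_def using assms by (intro prob_space_normal_density) simp

text \<open>The Borel sets of the plane form the product of the Borel sigma-algebras of the two
  lines, by \<open>borel_prod\<close>. This connects the pair measure with the Borel measures that
  \<open>consistent_estimator\<close> asks for.\<close>

lemma sets_drift_gauss2: "sets (drift_gauss2 \<sigma> t1 t2 x0 \<mu>) = sets borel"
  unfolding drift_gauss2_def borel_prod[symmetric]
  by (intro sets_pair_measure_cong sets_drift_gauss)

context
  fixes \<sigma> t1 t2 :: real
  assumes \<sigma>: "\<sigma> > 0" and t1: "t1 > 0" and t2: "t2 > 0"
begin

lemma prob_space_drift_gauss2: "prob_space (drift_gauss2 \<sigma> t1 t2 x0 \<mu>)"
  unfolding drift_gauss2_def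
  by (intro prob_space_pair prob_space_drift_gauss \<sigma> t1 t2)

lemma distributed_fst_drift_gauss2:
  "distributed (drift_gauss2 \<sigma> t1 t2 x0 \<mu>) lborel fst
     (normal_density (x0 + \<mu> * t1) (sqrt (\<sigma>\<^sup>2 * t1)))"
proof -
  let ?N1 = "drift_gauss \<sigma> x0 \<mu> t1" and ?N2 = "drift_gauss \<sigma> x0 \<mu> t2"
  \<comment> \<open>A push-forward depends on its target only through the sigma-algebra, so
    \<open>lborel\<close> may be exchanged for the factor.\<close>
  have "distr (?N1 \<Otimes>\<^sub>M ?N2) lborel fst = distr (?N1 \<Otimes>\<^sub>M ?N2) ?N1 fst"
    by (intro distr_cong) (simp_all add: sets_drift_gauss)
  also have "\<dots> = ?N1"
    by (intro prob_space.distr_pair_fst prob_space_drift_gauss \<sigma> t2)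
  finally show ?thesis
    by (auto simp: distributed_def drift_gauss2_def drift_gauss_def)
qed

lemma distributed_snd_drift_gauss2:
  "distributed (drift_gauss2 \<sigma> t1 t2 x0 \<mu>) lborel snd
     (normal_density (x0 + \<mu> * t2) (sqrt (\<sigma>\<^sup>2 * t2)))"
proof -
  let ?N1 = "drift_gauss \<sigma> x0 \<mu> t1" and ?N2 = "drift_gauss \<sigma> x0 \<mu> t2"
  have "distr (?N1 \<Otimes>\<^sub>M ?N2) lborel snd = distr (?N1 \<Otimes>\<^sub>M ?N2) ?N2 snd"
    by (intro distr_cong) (simp_all add: sets_drift_gauss)
  also have "\<dots> = ?N2"
    by (intro prob_space.distr_pair_snd prob_space_drift_gauss \<sigma> t1 t2)
  finally show ?thesis
    by (auto simp: distributed_def drift_gauss2_def drift_gauss_def)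
qed

lemma AE_drift_estimator_tendsto:
  assumes "t1 \<noteq> t2"
  shows "AE z in infinite_power (drift_gauss2 \<sigma> t1 t2 x0 \<mu>).
    (\<lambda>n. drift_estimator t1 t2 n (restrict z {1..n})) \<longlonglongrightarrow> (x0, \<mu>)"
proof -
  have "AE z in infinite_power (drift_gauss2 \<sigma> t1 t2 x0 \<mu>).
      (\<lambda>n. (\<Sum>k=1..n. fst (z k)) / real n) \<longlonglongrightarrow> x0 + \<mu> * t1"
    unfolding infinite_power_def using \<sigma> t1
    by (intro AE_PiM_gaussian_average_tendsto[OF prob_space_drift_gauss2
          distributed_fst_drift_gauss2]) simp
  moreover have "AE z in infinite_power (drift_gauss2 \<sigma> t1 t2 x0 \<mu>).
      (\<lambda>n. (\<Sum>k=1..n. snd (z k)) / real n) \<longlonglongrightarrow> x0 + \<mu> * t2"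
    unfolding infinite_power_def using \<sigma> t2
    by (intro AE_PiM_gaussian_average_tendsto[OF prob_space_drift_gauss2
          distributed_snd_drift_gauss2]) simp
  ultimately show ?thesis
  proof eventually_elim
    case (elim z)
    let ?a = "\<lambda>n. (\<Sum>k=1..n. fst (z k)) / real n" and ?b = "\<lambda>n. (\<Sum>k=1..n. snd (z k)) / real n"
    \<comment> \<open>These combinations invert the linear map from \<open>(x0, \<mu>)\<close> to
      the two means, whose determinant \<open>t2 - t1\<close> is nonzero.\<close>
    have "(\<lambda>n. ((t2 * ?a n - t1 * ?b n) / (t2 - t1), (?b n - ?a n) / (t2 - t1))) \<longlonglongrightarrow>
        ((t2 * (x0 + \<mu> * t1) - t1 * (x0 + \<mu> * t2)) / (t2 - t1),
         ((x0 + \<mu> * t2) - (x0 + \<mu> * t1)) / (t2 - t1))"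
      using assms by (intro tendsto_intros elim) auto
    moreover have "(t2 * (x0 + \<mu> * t1) - t1 * (x0 + \<mu> * t2)) / (t2 - t1) = x0"
      "((x0 + \<mu> * t2) - (x0 + \<mu> * t1)) / (t2 - t1) = \<mu>"
      using assms by (simp_all add: field_simps)
    \<comment> \<open>The equation also holds at \<open>n = 0\<close>, where the sums are empty and
      both sides are \<open>(0, 0)\<close>.\<close>
    moreover have "drift_estimator t1 t2 n (restrict z {1..n}) =
        ((t2 * ?a n - t1 * ?b n) / (t2 - t1), (?b n - ?a n) / (t2 - t1))" for n
      by (simp add: drift_estimator_def sum_subtractf flip: sum_distrib_left)
         (simp add: diff_divide_distrib)
    ultimately show ?case
      by simp
  qed
qed

end

lemma measurable_drift_estimator:
  "drift_estimator t1 t2 n \<in> measurable (PiM {1..n} (\<lambda>_. borel)) borel"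
proof -
  have [measurable]: "fst \<in> borel_measurable (borel :: (real \<times> real) measure)"
    "snd \<in> borel_measurable (borel :: (real \<times> real) measure)"
    by (intro borel_measurable_continuous_onI continuous_intros)+
  show ?thesis
    unfolding drift_estimator_def by measurable
qed

theorem theorem5p1:
  fixes \<sigma> t1 t2 :: real
  assumes "\<sigma> > 0" and "t1 > 0" and "t2 > 0" and "t1 \<noteq> t2"
  shows "(\<forall>x0 \<mu>. measure (infinite_power (drift_gauss2 \<sigma> t1 t2 x0 \<mu>))
            {z \<in> space (infinite_power (drift_gauss2 \<sigma> t1 t2 x0 \<mu>)).
               (\<lambda>n. drift_estimator t1 t2 n (restrict z {1..n})) \<longlonglongrightarrow> (x0, \<mu>)} = 1) \<and>
         consistent_estimator (drift_estimator t1 t2) (\<lambda>(x0, \<mu>). drift_gauss2 \<sigma> t1 t2 x0 \<mu>)"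
proof -
  have limit: "measure (infinite_power (drift_gauss2 \<sigma> t1 t2 x0 \<mu>))
      {z \<in> space (infinite_power (drift_gauss2 \<sigma> t1 t2 x0 \<mu>)).
         (\<lambda>n. drift_estimator t1 t2 n (restrict z {1..n})) \<longlonglongrightarrow> (x0, \<mu>)} = 1" for x0 \<mu>
  proof -
    let ?G = "drift_gauss2 \<sigma> t1 t2 x0 \<mu>"
    interpret P: prob_space "infinite_power ?G"
      unfolding infinite_power_def
      by (intro prob_space_PiM prob_space_drift_gauss2 assms)
    have [measurable]: "(\<lambda>z. drift_estimator t1 t2 n (restrict z {1..n}))
        \<in> borel_measurable (infinite_power ?G)" for n
    proof -
      have "(\<lambda>z. restrict z {1..n}) \<in> measurable (infinite_power ?G) (PiM {1..n} (\<lambda>_. ?G))"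
        unfolding infinite_power_def by (intro measurable_restrict_subset) auto
      \<comment> \<open>The estimator is measurable on tuples over \<open>borel\<close>; the factors
        \<open>?G\<close> have the same sets.\<close>
      also have "measurable (infinite_power ?G) (PiM {1..n} (\<lambda>_. ?G)) =
          measurable (infinite_power ?G) (PiM {1..n} (\<lambda>_. borel))"
        by (intro measurable_cong_sets sets_PiM_cong sets_drift_gauss2) auto
      finally show ?thesis
        by (rule measurable_compose[OF _ measurable_drift_estimator])
    qed
    \<comment> \<open>Measurability of the event is what allows the almost sure limit to be read as
      probability 1.\<close>
    have "{z \<in> space (infinite_power ?G).
        (\<lambda>n. drift_estimator t1 t2 n (restrict z {1..n})) \<longlonglongrightarrow> (x0, \<mu>)} \<in> P.events"
      by measurable
    then show ?thesis
      using AE_drift_estimator_tendsto[OF assms, of x0 \<mu>] by (simp add: P.prob_Collect_eq_1)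
  qed
  moreover have "prob_space (drift_gauss2 \<sigma> t1 t2 x0 \<mu>)" for x0 \<mu>
    using assms by (intro prob_space_drift_gauss2)
  ultimately show ?thesis
    unfolding consistent_estimator_def
    \<comment> \<open>Keeping \<open>1\<close> from becoming \<open>Suc 0\<close> lets
      \<open>measurable_drift_estimator\<close> match the index set \<open>{1..n}\<close>.\<close>
    by (auto simp: sets_drift_gauss2 measurable_drift_estimator simp del: One_nat_def)
qed

end
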